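(* For all $h,h'\in\omega^\omega$ going to infinity, $\min\{\mathfrak{b}^{\mathrm{LLc}}_{b,h}:b\in\omega^\omega\}=\min\{\mathfrak{b}^{\mathrm{LLc}}_{b,h'}:b\in\omega^\omega\}$ and $\sup\{\mathfrak{d}^{\mathrm{LLc}}_{b,h}:b\in\omega^\omega\}=\sup\{\mathfrak{d}^{\mathrm{LLc}}_{b,h'}:b\in\omega^\omega\}$.
   Context: For $b,h\in\omega^\omega$ (always with the convention $1\leq h(n)<b(n)$ for all $n$, so minima/suprema range over $b$ with $b>h$ pointwise): $\prod b=\prod_n b(n)$, $\mathcal{S}(b,h)=\prod_n[b(n)]^{\leq h(n)}$. For $x\in\prod b$, $\varphi\in\mathcal{S}(b,h)$, $D\in[\omega]^\omega$, $x\in^*_D\varphi$ iff $x(n)\in\varphi(n)$ for all but finitely many $n\in D$. $\mathfrak{b}^{\mathrm{LLc}}_{b,h}$ is the least size of $F\subseteq\prod b$ such that no pair $(D,\varphi)\in[\omega]^\omega\times\mathcal{S}(b,h)$ satisfies $x\in^*_D\varphi$ for all $x\in F$; $\mathfrak{d}^{\mathrm{LLc}}_{b,h}$ is the least size of a family $\Phi\subseteq[\omega]^\omega\times\mathcal{S}(b,h)$ such that every $x\in\prod b$ satisfies $x\in^*_D\varphi$ for some $(D,\varphi)\in\Phi$. *)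

theory Defs
  imports Complex_Main "HOL-Library.FuncSet"
begin

unbundle cardinal_syntax

text \<open>Cardinals are cardinal orders on a type and are compared up to \<open>=o\<close>. The next two
  operators pick a representative of the minimum and of the supremum of a set of cardinal orders
  on one type. The existence and minimality lemmas below show that the choice is always possible
  (for a nonempty set in the case of the minimum), and that the supremum is the least
  one even among cardinals living on other types.\<close>

definition card_min :: "'a rel set \<Rightarrow> 'a rel" where
  "card_min R = (SOME r. r \<in> R \<and> (\<forall>s\<in>R. r \<le>o s))"

definition card_sup :: "'a rel set \<Rightarrow> 'a rel" where
  "card_sup R = card_min {r. Card_order r \<and> (\<forall>s\<in>R. s \<le>o r)}"

lemma card_min:
  assumes "R \<noteq> {}" "\<forall>r\<in>R. Card_order r"
  shows "card_min R \<in> R" and "s \<in> R \<Longrightarrow> card_min R \<le>o s"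
proof -
  have "\<exists>r. r \<in> R \<and> (\<forall>s\<in>R. r \<le>o s)"
    using exists_minim_Card_order[OF assms] by blast
  from someI_ex[OF this] show "card_min R \<in> R" "s \<in> R \<Longrightarrow> card_min R \<le>o s"
    unfolding card_min_def by blast+
qed

lemma card_sup:
  fixes R :: "'a rel set" and k :: "'b rel"
  assumes R: "\<forall>r\<in>R. Card_order r"
  shows "Card_order (card_sup R)"
    and "s \<in> R \<Longrightarrow> s \<le>o card_sup R"
    and "Card_order k \<Longrightarrow> \<forall>s\<in>R. s \<le>o k \<Longrightarrow> card_sup R \<le>o k"
proof -
  let ?U = "{r :: 'a rel. Card_order r \<and> (\<forall>s\<in>R. s \<le>o r)}"
  have bnd: "s \<le>o |UNIV :: 'a set|" if "s \<in> R" for s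
  proof -
    have "s =o |Field s|"
      using R that by (intro ordIso_symmetric[OF card_of_Field_ordIso]) blast
    then show ?thesis
      by (rule ordIso_ordLeq_trans) (rule card_of_mono1[OF subset_UNIV])
  qed
  then have U: "|UNIV :: 'a set| \<in> ?U"
    by (auto intro: card_of_Card_order)
  then have ne: "?U \<noteq> {}" by blast
  have co: "\<forall>r\<in>?U. Card_order r" by blast
  note m = card_min[OF ne co, folded card_sup_def]
  show "Card_order (card_sup R)" using m(1) by blast
  show "s \<in> R \<Longrightarrow> s \<le>o card_sup R" using m(1) by blast
  assume k: "Card_order k" and ub: "\<forall>s\<in>R. s \<le>o k"
  have "k \<le>o |UNIV :: 'a set| \<or> |UNIV :: 'a set| \<le>o k"
    using k by (intro ordLeq_total card_of_Well_order) (simp add: card_order_on_def)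
  then show "card_sup R \<le>o k"
  proof
    assume "|UNIV :: 'a set| \<le>o k"
    with m(2)[OF U] show ?thesis by (rule ordLeq_transitive)
  next
    assume "k \<le>o |UNIV :: 'a set|"
    then obtain p :: "'a rel" where p: "k =o p"
      unfolding internalize_ordLeq[of k] by blast
    have "Card_order p" using Card_order_ordIso2[OF k p] .
    moreover have "\<forall>s\<in>R. s \<le>o p" using ub ordLeq_ordIso_trans[OF _ p] by blast
    ultimately have "card_sup R \<le>o p" using m(2) by blast
    then show ?thesis by (rule ordLeq_ordIso_trans) (rule ordIso_symmetric[OF p])
  qed
qed

definition seqs :: "(nat \<Rightarrow> nat) \<Rightarrow> (nat \<Rightarrow> nat) set" where
  "seqs b = (\<Pi> n\<in>UNIV. {..<b n})"

definition slaloms :: "(nat \<Rightarrow> nat) \<Rightarrow> (nat \<Rightarrow> nat) \<Rightarrow> (nat \<Rightarrow> nat set) set" where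
  "slaloms b h = (\<Pi> n\<in>UNIV. {A. A \<subseteq> {..<b n} \<and> card A \<le> h n})"

definition localized_on :: "nat set \<Rightarrow> (nat \<Rightarrow> nat) \<Rightarrow> (nat \<Rightarrow> nat set) \<Rightarrow> bool" where
  "localized_on D x \<phi> \<longleftrightarrow> finite {n \<in> D. x n \<notin> \<phi> n}"

definition b_LLc :: "(nat \<Rightarrow> nat) \<Rightarrow> (nat \<Rightarrow> nat) \<Rightarrow> (nat \<Rightarrow> nat) rel" where
  "b_LLc b h = card_min {|F| | F. F \<subseteq> seqs b \<and>
     \<not> (\<exists>(D, \<phi>) \<in> {D. infinite D} \<times> slaloms b h. \<forall>x\<in>F. localized_on D x \<phi>)}"

definition d_LLc :: "(nat \<Rightarrow> nat) \<Rightarrow> (nat \<Rightarrow> nat) \<Rightarrow> (nat set \<times> (nat \<Rightarrow> nat set)) rel" where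
  "d_LLc b h = card_min {|\<Phi>| | \<Phi>. \<Phi> \<subseteq> {D. infinite D} \<times> slaloms b h \<and>
     (\<forall>x\<in>seqs b. \<exists>(D, \<phi>) \<in> \<Phi>. localized_on D x \<phi>)}"

text \<open>The minima defining the two cardinals are taken over nonempty sets.\<close>

lemma b_LLc_nonempty:
  assumes "\<forall>n. h n < b n"
  shows "\<not> (\<exists>(D, \<phi>) \<in> {D. infinite D} \<times> slaloms b h. \<forall>x\<in>seqs b. localized_on D x \<phi>)"
proof clarify
  fix D \<phi> assume D: "infinite D" and \<phi>: "\<phi> \<in> slaloms b h"
    and loc: "\<forall>x\<in>seqs b. localized_on D x \<phi>"
  have "\<exists>k<b n. k \<notin> \<phi> n" for n
  proof (rule ccontr)
    assume "\<not> ?thesis"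
    with \<phi> have "\<phi> n = {..<b n}" and "card (\<phi> n) \<le> h n" unfolding slaloms_def by auto
    with spec[OF assms, of n] show False by simp
  qed
  then obtain x where x: "\<And>n. x n < b n" "\<And>n. x n \<notin> \<phi> n" by metis
  then have "finite {n \<in> D. x n \<notin> \<phi> n}"
    using loc unfolding localized_on_def seqs_def by blast
  with x D show False by simp
qed

lemma d_LLc_nonempty:
  assumes "\<forall>n. 1 \<le> h n" and "x \<in> seqs b"
  shows "\<exists>(D, \<phi>) \<in> {D. infinite D} \<times> slaloms b h. localized_on D x \<phi>"
  using assms
  by (intro bexI[of _ "(UNIV, \<lambda>n. {x n})"]) (auto simp: localized_on_def slaloms_def seqs_def)

end

theory Submission
  imports Defs
begin

text \<open>Since \<open>D\<close> may be any infinite set, localization can be transferred along subsequences: given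
  \<open>b > h\<close>, pick a strictly increasing \<open>a\<close> with \<open>h'(n) \<le> h(a(n))\<close> and put \<open>b' = b \<circ> a > h'\<close>.
  If \<open>x \<circ> a\<close> is localized on \<open>D\<close> by an \<open>h'\<close>-slalom \<open>\<phi>\<close>, then \<open>x\<close> is localized on \<open>a[D]\<close> by the
  \<open>h\<close>-slalom that copies \<open>\<phi>(n)\<close> to position \<open>a(n)\<close>. This Tukey connection gives
  \<open>b_LLc b' h' \<le>o b_LLc b h\<close> and \<open>d_LLc b h \<le>o d_LLc b' h'\<close>; then exchange \<open>h\<close> and \<open>h'\<close>.\<close>

text \<open>For injective \<open>a\<close> this moves the set at \<open>n\<close> to position
  \<open>a n\<close>. Positions outside \<open>range a\<close> get the empty set, which satisfies
  every slalom bound; localization is only tested on a[D], so they do no harm.\<close>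

definition push_slalom :: "(nat \<Rightarrow> nat) \<Rightarrow> (nat \<Rightarrow> nat set) \<Rightarrow> nat \<Rightarrow> nat set" where
  "push_slalom a \<phi> m = (if m \<in> range a then \<phi> (inv a m) else {})"

lemma push_slalom_apply [simp]: "inj a \<Longrightarrow> push_slalom a \<phi> (a n) = \<phi> n"
  by (simp add: push_slalom_def)

lemma push_slalom_in_slaloms:
  assumes "inj a" "\<forall>n. h' n \<le> h (a n)" "\<phi> \<in> slaloms (b \<circ> a) h'"
  shows "push_slalom a \<phi> \<in> slaloms b h"
proof -
  have "push_slalom a \<phi> m \<subseteq> {..<b m} \<and> card (push_slalom a \<phi> m) \<le> h m" for m
  proof (cases "m \<in> range a")
    case True
    then obtain n where m: "m = a n" by blast
    have "\<phi> n \<subseteq> {..<b (a n)}" "card (\<phi> n) \<le> h' n"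
      using assms(3) by (auto simp: slaloms_def)
    then show ?thesis
      using assms(1) spec[OF assms(2), of n] by (simp add: m)
  qed (simp add: push_slalom_def)
  then show ?thesis by (simp add: slaloms_def)
qed

text \<open>The exceptional set along a[D] is exactly the image under \<open>a\<close> of the
  exceptional set along \<open>D\<close>, so finiteness carries over.\<close>

lemma localized_on_push_slalom:
  assumes "inj a" "localized_on D (x \<circ> a) \<phi>"
  shows "localized_on (a ` D) x (push_slalom a \<phi>)"
proof -
  have "{m \<in> a ` D. x m \<notin> push_slalom a \<phi> m} = a ` {n \<in> D. (x \<circ> a) n \<notin> \<phi> n}"
    using assms(1) by auto
  then show ?thesis using assms(2) by (simp add: localized_on_def)
qed

text \<open>The minimum is attained because the defining set is inhabited: \<open>h < b\<close>
  makes all of \<open>seqs b\<close> an unlocalizable family.\<close>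

lemma b_LLc_witness:
  assumes "\<forall>n. h n < b n"
  obtains F where "F \<subseteq> seqs b" "b_LLc b h = |F|"
    "\<not> (\<exists>(D, \<phi>) \<in> {D. infinite D} \<times> slaloms b h. \<forall>x\<in>F. localized_on D x \<phi>)"
proof -
  let ?R = "{|F| | F. F \<subseteq> seqs b \<and>
     \<not> (\<exists>(D, \<phi>) \<in> {D. infinite D} \<times> slaloms b h. \<forall>x\<in>F. localized_on D x \<phi>)}"
  have "|seqs b| \<in> ?R"
    by (rule CollectI, rule exI[of _ "seqs b"]) (intro conjI refl subset_refl b_LLc_nonempty[OF assms])
  then have "?R \<noteq> {}" by blast
  moreover have "\<forall>r\<in>?R. Card_order r" by (auto intro: card_of_Card_order)
  ultimately have "b_LLc b h \<in> ?R" unfolding b_LLc_def by (rule card_min(1))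
  then show thesis using that by blast
qed

lemma b_LLc_le:
  assumes "F \<subseteq> seqs b"
    "\<not> (\<exists>(D, \<phi>) \<in> {D. infinite D} \<times> slaloms b h. \<forall>x\<in>F. localized_on D x \<phi>)"
  shows "b_LLc b h \<le>o |F|"
proof -
  let ?R = "{|F| | F. F \<subseteq> seqs b \<and>
     \<not> (\<exists>(D, \<phi>) \<in> {D. infinite D} \<times> slaloms b h. \<forall>x\<in>F. localized_on D x \<phi>)}"
  have "|F| \<in> ?R" by (rule CollectI, rule exI[of _ F]) (intro conjI refl assms)
  moreover from this have "?R \<noteq> {}" by blast
  moreover have "\<forall>r\<in>?R. Card_order r" by (auto intro: card_of_Card_order)
  ultimately show ?thesis unfolding b_LLc_def by (intro card_min(2))
qed

text \<open>Here the set of all pairs is the covering family: since \<open>1 \<le> h n\<close>, each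
  \<open>x\<close> is localized by its own singletons.\<close>

lemma d_LLc_witness:
  assumes "\<forall>n. 1 \<le> h n"
  obtains \<Phi> where "\<Phi> \<subseteq> {D. infinite D} \<times> slaloms b h" "d_LLc b h = |\<Phi>|"
    "\<forall>x\<in>seqs b. \<exists>(D, \<phi>) \<in> \<Phi>. localized_on D x \<phi>"
proof -
  let ?R = "{|\<Phi>| | \<Phi>. \<Phi> \<subseteq> {D. infinite D} \<times> slaloms b h \<and>
     (\<forall>x\<in>seqs b. \<exists>(D, \<phi>) \<in> \<Phi>. localized_on D x \<phi>)}"
  have "|{D. infinite D} \<times> slaloms b h| \<in> ?R"
    using d_LLc_nonempty[OF assms] by (intro CollectI exI conjI refl ballI) auto
  then have "?R \<noteq> {}" by blast
  moreover have "\<forall>r\<in>?R. Card_order r" by (auto intro: card_of_Card_order)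
  ultimately have "d_LLc b h \<in> ?R" unfolding d_LLc_def by (rule card_min(1))
  then show thesis using that by blast
qed

lemma d_LLc_le:
  assumes "\<Phi> \<subseteq> {D. infinite D} \<times> slaloms b h"
    "\<forall>x\<in>seqs b. \<exists>(D, \<phi>) \<in> \<Phi>. localized_on D x \<phi>"
  shows "d_LLc b h \<le>o |\<Phi>|"
proof -
  let ?R = "{|\<Phi>| | \<Phi>. \<Phi> \<subseteq> {D. infinite D} \<times> slaloms b h \<and>
     (\<forall>x\<in>seqs b. \<exists>(D, \<phi>) \<in> \<Phi>. localized_on D x \<phi>)}"
  have "|\<Phi>| \<in> ?R" by (rule CollectI, rule exI[of _ \<Phi>]) (intro conjI refl assms)
  moreover from this have "?R \<noteq> {}" by blast
  moreover have "\<forall>r\<in>?R. Card_order r" by (auto intro: card_of_Card_order)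
  ultimately show ?thesis unfolding d_LLc_def by (intro card_min(2))
qed

lemma Card_order_b_LLc: "\<forall>n. h n < b n \<Longrightarrow> Card_order (b_LLc b h)"
  by (erule b_LLc_witness) (simp add: card_of_Card_order)

lemma Card_order_d_LLc: "\<forall>n. 1 \<le> h n \<Longrightarrow> Card_order (d_LLc b h)"
  by (erule d_LLc_witness[where b = b]) (simp add: card_of_Card_order)

text \<open>Restrict the members of a smallest unlocalizable family \<open>F\<close> to the
  subsequence. A pair localizing all restrictions would push forward to a pair localizing
  \<open>F\<close>.\<close>

lemma b_LLc_subseq_le:
  assumes a: "inj a" "\<forall>n. h' n \<le> h (a n)" and b: "\<forall>n. h n < b n"
  shows "b_LLc (b \<circ> a) h' \<le>o b_LLc b h"
proof -
  obtain F where F: "F \<subseteq> seqs b" "b_LLc b h = |F|"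
    "\<not> (\<exists>(D, \<phi>) \<in> {D. infinite D} \<times> slaloms b h. \<forall>x\<in>F. localized_on D x \<phi>)"
    using b_LLc_witness[OF b] .
  let ?F = "(\<lambda>x. x \<circ> a) ` F"
  have "?F \<subseteq> seqs (b \<circ> a)" using F(1) by (fastforce simp: seqs_def)
  moreover have "\<not> (\<exists>(D, \<phi>) \<in> {D. infinite D} \<times> slaloms (b \<circ> a) h'. \<forall>y\<in>?F. localized_on D y \<phi>)"
  proof clarify
    fix D \<phi>
    assume D: "infinite D" and \<phi>: "\<phi> \<in> slaloms (b \<circ> a) h'"
      and loc: "\<forall>y\<in>?F. localized_on D y \<phi>"
    have "infinite (a ` D)"
      using D by (simp add: finite_image_iff inj_on_subset[OF a(1)])
    moreover have "push_slalom a \<phi> \<in> slaloms b h"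
      using push_slalom_in_slaloms[of a h' h, OF a \<phi>] .
    moreover have "\<forall>x\<in>F. localized_on (a ` D) x (push_slalom a \<phi>)"
      using loc localized_on_push_slalom[OF a(1)] by blast
    ultimately show False using F(3) by blast
  qed
  ultimately have "b_LLc (b \<circ> a) h' \<le>o |?F|" by (rule b_LLc_le)
  \<comment> \<open>Composition with \<open>a\<close> may identify members of \<open>F\<close>, but
    an image is never larger.\<close>
  then show ?thesis unfolding F(2) using card_of_image by (rule ordLeq_transitive)
qed

text \<open>The dual half: pushing forward a smallest covering family for \<open>b \<circ> a\<close>
  covers \<open>seqs b\<close>, because each \<open>x \<circ> a\<close> was covered.\<close>

lemma d_LLc_le_subseq:
  assumes a: "inj a" "\<forall>n. h' n \<le> h (a n)" and h': "\<forall>n. 1 \<le> h' n"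
  shows "d_LLc b h \<le>o d_LLc (b \<circ> a) h'"
proof -
  obtain \<Phi> where \<Phi>: "\<Phi> \<subseteq> {D. infinite D} \<times> slaloms (b \<circ> a) h'" "d_LLc (b \<circ> a) h' = |\<Phi>|"
    "\<forall>x\<in>seqs (b \<circ> a). \<exists>(D, \<phi>) \<in> \<Phi>. localized_on D x \<phi>"
    using d_LLc_witness[OF h'] .
  let ?G = "\<lambda>(D, \<phi>). (a ` D, push_slalom a \<phi>)"
  have "infinite (a ` D)" if "infinite D" for D
    using that by (simp add: finite_image_iff inj_on_subset[OF a(1)])
  then have "?G ` \<Phi> \<subseteq> {D. infinite D} \<times> slaloms b h"
    using \<Phi>(1) push_slalom_in_slaloms[of a h' h, OF a] by auto
  moreover have "\<forall>x\<in>seqs b. \<exists>(D, \<phi>) \<in> ?G ` \<Phi>. localized_on D x \<phi>"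
  proof
    fix x assume "x \<in> seqs b"
    then have "x \<circ> a \<in> seqs (b \<circ> a)" by (auto simp: seqs_def)
    then obtain D \<phi> where "(D, \<phi>) \<in> \<Phi>" "localized_on D (x \<circ> a) \<phi>" using \<Phi>(3) by blast
    then show "\<exists>(D, \<phi>) \<in> ?G ` \<Phi>. localized_on D x \<phi>"
      using localized_on_push_slalom[OF a(1)] by force
  qed
  ultimately have "d_LLc b h \<le>o |?G ` \<Phi>|" by (rule d_LLc_le)
  then show ?thesis unfolding \<Phi>(2) using card_of_image by (rule ordLeq_transitive)
qed

lemma dominating_subseq:
  fixes h h' :: "nat \<Rightarrow> nat"
  assumes "filterlim h at_top sequentially"
  obtains a where "strict_mono a" "\<forall>n. h' n \<le> h (a n)"
proof -
  have ex: "\<exists>m>k. h' n \<le> h m" for k n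
  proof -
    have "eventually (\<lambda>m. h' n \<le> h m) sequentially"
      using assms by (simp add: filterlim_at_top)
    then obtain N where "\<forall>m\<ge>N. h' n \<le> h m" unfolding eventually_sequentially by blast
    \<comment> \<open>\<open>N\<close> secures the domination and \<open>Suc k\<close> the strict
      increase.\<close>
    then show ?thesis by (intro exI[of _ "max N (Suc k)"]) auto
  qed
  have "\<exists>a. \<forall>n. h' n \<le> h (a n) \<and> a n < a (Suc n)"
    \<comment> \<open>\<open>ex\<close> supplies both the initial value and each successor beyond
      the previous one.\<close>
    by (rule dependent_nat_choice) (use ex in blast)+
  then show thesis using that by (metis strict_mono_Suc_iff)
qed

text \<open>A single \<open>b' = b \<circ> a\<close> serves both cardinals; it is admissible because
  \<open>h' n \<le> h (a n) < b (a n)\<close>.\<close>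

lemma LLc_transfer:
  assumes "filterlim h at_top sequentially" "\<forall>n. 1 \<le> h' n" "\<forall>n. h n < b n"
  obtains b' where "\<forall>n. h' n < b' n" "b_LLc b' h' \<le>o b_LLc b h" "d_LLc b h \<le>o d_LLc b' h'"
proof -
  obtain a where a: "strict_mono a" "\<forall>n. h' n \<le> h (a n)"
    using dominating_subseq[OF assms(1)] .
  have inj: "inj a" using a(1) by (rule strict_mono_imp_inj_on)
  show thesis
  proof
    show "\<forall>n. h' n < (b \<circ> a) n"
      using a(2) assms(3) by (auto intro: le_less_trans)
    show "b_LLc (b \<circ> a) h' \<le>o b_LLc b h"
      using inj a(2) assms(3) by (rule b_LLc_subseq_le)
    show "d_LLc b h \<le>o d_LLc (b \<circ> a) h'"
      using inj a(2) assms(2) by (rule d_LLc_le_subseq)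
  qed
qed

text \<open>Transfer a \<open>b\<close> that attains the minimum for \<open>h\<close>; the resulting
  \<open>b'\<close> competes in the minimum for \<open>h'\<close>.\<close>

lemma min_b_LLc_le:
  assumes "filterlim h at_top sequentially" "\<forall>n. 1 \<le> h' n"
  shows "card_min {b_LLc b h' | b. \<forall>n. h' n < b n} \<le>o card_min {b_LLc b h | b. \<forall>n. h n < b n}"
proof -
  have "{b_LLc b h | b. \<forall>n. h n < b n} \<noteq> {}"
    \<comment> \<open>\<open>Suc (h n)\<close> is the least admissible bound, so the minimum ranges
      over a nonempty set.\<close>
    by (auto intro!: exI[of _ "\<lambda>n. Suc (h n)"])
  moreover have "\<forall>r\<in>{b_LLc b h | b. \<forall>n. h n < b n}. Card_order r"
    using Card_order_b_LLc by blast
  ultimately have "card_min {b_LLc b h | b. \<forall>n. h n < b n} \<in> {b_LLc b h | b. \<forall>n. h n < b n}"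
    by (rule card_min(1))
  then obtain b where b: "\<forall>n. h n < b n"
    and min: "card_min {b_LLc b h | b. \<forall>n. h n < b n} = b_LLc b h" by blast
  obtain b' where b': "\<forall>n. h' n < b' n" "b_LLc b' h' \<le>o b_LLc b h"
    using LLc_transfer[OF assms b] .
  have "card_min {b_LLc b h' | b. \<forall>n. h' n < b n} \<le>o b_LLc b' h'"
    by (rule card_min(2)) (use b'(1) Card_order_b_LLc in blast)+
  then show ?thesis unfolding min using b'(2) by (rule ordLeq_transitive)
qed

text \<open>Each \<open>d_LLc b h\<close> lies below some \<open>d_LLc b' h'\<close>, so the
  supremum for \<open>h'\<close> is an upper bound of the set for \<open>h\<close>, and leastness
  applies.\<close>

lemma sup_d_LLc_le:
  assumes "filterlim h at_top sequentially" "\<forall>n. 1 \<le> h n" "\<forall>n. 1 \<le> h' n"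
  shows "card_sup {d_LLc b h | b. \<forall>n. h n < b n} \<le>o card_sup {d_LLc b h' | b. \<forall>n. h' n < b n}"
proof (rule card_sup(3))
  let ?R = "{d_LLc b h' | b. \<forall>n. h' n < b n}"
  have co: "\<forall>r\<in>?R. Card_order r" using Card_order_d_LLc[OF assms(3)] by blast
  show "\<forall>r\<in>{d_LLc b h | b. \<forall>n. h n < b n}. Card_order r"
    using Card_order_d_LLc[OF assms(2)] by blast
  show "Card_order (card_sup ?R)" using co by (rule card_sup(1))
  show "\<forall>s\<in>{d_LLc b h | b. \<forall>n. h n < b n}. s \<le>o card_sup ?R"
  proof clarify
    fix b assume b: "\<forall>n. h n < b n"
    obtain b' where b': "\<forall>n. h' n < b' n" "d_LLc b h \<le>o d_LLc b' h'"
      using LLc_transfer[OF assms(1,3) b] .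
    have "d_LLc b' h' \<le>o card_sup ?R"
      using co by (rule card_sup(2)) (use b'(1) in blast)
    with b'(2) show "d_LLc b h \<le>o card_sup ?R" by (rule ordLeq_transitive)
  qed
qed

theorem theorem2p8:
  fixes h h' :: "nat \<Rightarrow> nat"
  assumes "\<forall>n. 1 \<le> h n" and "filterlim h at_top sequentially"
    and "\<forall>n. 1 \<le> h' n" and "filterlim h' at_top sequentially"
  shows "card_min {b_LLc b h | b. \<forall>n. h n < b n} =o card_min {b_LLc b h' | b. \<forall>n. h' n < b n}
    \<and> card_sup {d_LLc b h | b. \<forall>n. h n < b n} =o card_sup {d_LLc b h' | b. \<forall>n. h' n < b n}"
  \<comment> \<open>Antisymmetry: both inequalities are applied twice, with \<open>h\<close> and
    \<open>h'\<close> exchanged.\<close>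
  using assms by (simp add: ordIso_iff_ordLeq min_b_LLc_le sup_d_LLc_le)

end
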